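(* Let $1\leq p,q,r<\infty$ and let $\pmb{w}=\{w_j\}_{j\in\mathbb{Z}}$ be a multiplicative vector weight, i.e. $w_1>0$ and $w_j=w_1^j$ for all $j\in\mathbb{Z}$ (so that $w_{i+j}=w_iw_j$ for all $i,j\in\mathbb{Z}$). Let $\lambda=2^{j_0}$ for some $j_0\in\mathbb{Z}$, and set $f_\lambda(x)=f(\lambda x)$. Then for every $f\in\mathfrak{M}^{p,q,r}_{\pmb{w}}(\mathbb{R}^d)$, $$\|f_\lambda\|_{\mathfrak{M}^{p,q,r}_{\pmb{w}}}=\lambda^{\log_2(w_1)-\frac dp}\,\|f\|_{\mathfrak{M}^{p,q,r}_{\pmb{w}}}.$$
   Context: The Fourier transform is $\widehat f(\xi)=\int_{\mathbb{R}^d} f(x)e^{-2\pi i x\cdot\xi}\,dx$; for tempered distributions $f$, the dilation $f_\lambda$ is understood in the usual distributional sense. Fix $\psi\in\mathcal{S}(\mathbb{R}^d)$ (Schwartz class) with $\operatorname{supp}\psi\subset[-1,1]^d$ and $\sum_{k\in\mathbb{Z}^d}\psi(\xi-k)\equiv 1$. For $j\in\mathbb{Z}$ and $k\in\mathbb{Z}^d$ let $$\psi_{j,k}(D)f(x)=\int_{\mathbb{R}^d}\psi(2^{-j}\xi-k)\widehat f(\xi)e^{2\pi i x\cdot\xi}\,d\xi ,\qquad \|f\|_{M^{p,q}_{[j]}}=\Big(\sum_{k\in\mathbb{Z}^d}\|\psi_{j,k}(D)f\|_{L^p(\mathbb{R}^d)}^q\Big)^{1/q}.$$ A vector weight is a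 sequence $\pmb{w}=\{w_j\}_{j\in\mathbb{Z}}$ with $w_j\ge 0$. For $1\le p,q,r<\infty$, $\mathfrak{M}^{p,q,r}_{\pmb{w}}(\mathbb{R}^d)$ is the collection of all tempered distributions $f\in\mathcal{S}'(\mathbb{R}^d)$ such that $$\|f\|_{\mathfrak{M}^{p,q,r}_{\pmb{w}}}:=\Big(\sum_{j\in\mathbb{Z}}w_j^r\|f\|_{M^{p,q}_{[j]}}^r\Big)^{1/r}<\infty.$$ *)

theory Defs
  imports "HOL-Analysis.Analysis"
begin

section \<open>Schwartz functions and tempered distributions on \<open>real ^ 'n\<close>\<close>

definition partial :: "'n::finite \<Rightarrow> (real ^ 'n \<Rightarrow> complex) \<Rightarrow> real ^ 'n \<Rightarrow> complex" where
  "partial i \<phi> x = vector_derivative (\<lambda>t. \<phi> (x + t *\<^sub>R axis i 1)) (at 0)"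

text \<open>Iterated partial derivatives are indexed by lists of coordinates. For smooth functions
  the order is irrelevant, so these are the derivatives indexed by multi-indices.\<close>

definition partials :: "'n::finite list \<Rightarrow> (real ^ 'n \<Rightarrow> complex) \<Rightarrow> real ^ 'n \<Rightarrow> complex" where
  "partials bs \<phi> = foldr partial bs \<phi>"

definition smooth :: "(real ^ 'n::finite \<Rightarrow> complex) \<Rightarrow> bool" where
  "smooth \<phi> \<longleftrightarrow> (\<forall>bs x. partials bs \<phi> differentiable at x)"

definition monomial :: "('n::finite \<Rightarrow> nat) \<Rightarrow> real ^ 'n \<Rightarrow> real" where
  "monomial \<alpha> x = (\<Prod>i\<in>UNIV. (x $ i) ^ \<alpha> i)"

definition schwartz :: "(real ^ 'n::finite \<Rightarrow> complex) set" where
  "schwartz = {\<phi>. smooth \<phi> \<and> (\<forall>\<alpha> bs. bounded (range (\<lambda>x. monomial \<alpha> x *\<^sub>R partials bs \<phi> x)))}"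

definition schwartz_seminorm ::
    "('n::finite \<Rightarrow> nat) \<Rightarrow> 'n list \<Rightarrow> (real ^ 'n \<Rightarrow> complex) \<Rightarrow> real" where
  "schwartz_seminorm \<alpha> bs \<phi> = (SUP x. norm (monomial \<alpha> x *\<^sub>R partials bs \<phi> x))"

text \<open>A distribution is represented by a functional on all functions, of which only the values
  on Schwartz functions are meaningful. Since the Schwartz space is metrizable, continuity is
  sequential continuity, which by linearity need only be required at \<open>0\<close>.\<close>

definition tempered_distributions :: "((real ^ 'n::finite \<Rightarrow> complex) \<Rightarrow> complex) set" where
  "tempered_distributions = {f.
     (\<forall>\<phi>\<in>schwartz. \<forall>\<eta>\<in>schwartz. \<forall>a b.
        f (\<lambda>x. a * \<phi> x + b * \<eta> x) = a * f \<phi> + b * f \<eta>) \<and>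
     (\<forall>\<Phi>. range \<Phi> \<subseteq> schwartz \<longrightarrow>
        (\<forall>\<alpha> bs. (\<lambda>n::nat. schwartz_seminorm \<alpha> bs (\<Phi> n)) \<longlonglongrightarrow> 0) \<longrightarrow>
        (\<lambda>n. f (\<Phi> n)) \<longlonglongrightarrow> 0)}"

text \<open>The dilation \<open>f\<^sub>c(x) = f(c x)\<close>, \<open>c > 0\<close>, of a distribution, transposing the change of
  variables \<open>\<integral> f (c x) \<phi> x dx = c\<^sup>-\<^sup>d \<integral> f y \<phi> (y / c) dy\<close>.\<close>

definition dilate ::
    "real \<Rightarrow> ((real ^ 'n::finite \<Rightarrow> complex) \<Rightarrow> complex) \<Rightarrow> (real ^ 'n \<Rightarrow> complex) \<Rightarrow> complex" where
  "dilate c f \<phi> = f (\<lambda>y. \<phi> ((1 / c) *\<^sub>R y)) / of_real (c ^ CARD('n))"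

definition fourier :: "(real ^ 'n::finite \<Rightarrow> complex) \<Rightarrow> real ^ 'n \<Rightarrow> complex" where
  "fourier \<phi> \<xi> = (\<integral>x. \<phi> x * exp (- 2 * pi * \<i> * (x \<bullet> \<xi>)) \<partial>lborel)"

definition fourier_dist ::
    "((real ^ 'n::finite \<Rightarrow> complex) \<Rightarrow> complex) \<Rightarrow> (real ^ 'n \<Rightarrow> complex) \<Rightarrow> complex" where
  "fourier_dist f \<phi> = f (fourier \<phi>)"


section \<open>The spaces\<close>

definition int_vec :: "int ^ 'n::finite \<Rightarrow> real ^ 'n" where
  "int_vec k = (\<chi> i. of_int (k $ i))"

definition window :: "(real ^ 'n::finite \<Rightarrow> complex) \<Rightarrow> bool" where
  "window \<psi> \<longleftrightarrow> \<psi> \<in> schwartz \<and>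
     closure {\<xi>. \<psi> \<xi> \<noteq> 0} \<subseteq> {\<xi>. \<forall>i. \<xi> $ i \<in> {-1..1}} \<and>
     (\<forall>\<xi>. ((\<lambda>k. \<psi> (\<xi> - int_vec k)) has_sum 1) UNIV)"

text \<open>For a tempered distribution \<open>f\<close>, the integral
  \<open>\<integral> \<psi> (2\<^sup>-\<^sup>j \<xi> - k) f\<^sup>^(\<xi>) exp (2 \<pi> \<i> x \<bullet> \<xi>) d\<xi>\<close> is the pairing of the Fourier transform of \<open>f\<close> with
  a test function of compact support; as a function of \<open>x\<close> it is smooth and represents the
  distribution obtained from \<open>f\<close> by the Fourier multiplier \<open>\<psi> (2\<^sup>-\<^sup>j \<xi> - k)\<close>.\<close>

definition freq_block ::
    "(real ^ 'n::finite \<Rightarrow> complex) \<Rightarrow> int \<Rightarrow> int ^ 'n \<Rightarrow>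
     ((real ^ 'n \<Rightarrow> complex) \<Rightarrow> complex) \<Rightarrow> real ^ 'n \<Rightarrow> complex" where
  "freq_block \<psi> j k f x =
     fourier_dist f (\<lambda>\<xi>. \<psi> (2 powi (-j) *\<^sub>R \<xi> - int_vec k) * exp (2 * pi * \<i> * (x \<bullet> \<xi>)))"

text \<open>Only used for positive exponents.\<close>

definition ennpowr :: "ennreal \<Rightarrow> real \<Rightarrow> ennreal" where
  "ennpowr x a = (if x = \<infinity> then \<infinity> else ennreal (enn2real x powr a))"

definition Lp_norm :: "real \<Rightarrow> (real ^ 'n::finite \<Rightarrow> complex) \<Rightarrow> ennreal" where
  "Lp_norm p g = ennpowr (\<integral>\<^sup>+x. ennreal (norm (g x) powr p) \<partial>lborel) (1 / p)"

definition modulation_norm ::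
    "(real ^ 'n::finite \<Rightarrow> complex) \<Rightarrow> real \<Rightarrow> real \<Rightarrow> int \<Rightarrow>
     ((real ^ 'n \<Rightarrow> complex) \<Rightarrow> complex) \<Rightarrow> ennreal" where
  "modulation_norm \<psi> p q j f =
     ennpowr (\<Sum>\<^sub>\<infinity>k\<in>UNIV. ennpowr (Lp_norm p (freq_block \<psi> j k f)) q) (1 / q)"

definition vector_weight :: "(int \<Rightarrow> real) \<Rightarrow> bool" where
  "vector_weight w \<longleftrightarrow> (\<forall>j. w j \<ge> 0)"

definition multiplicative_vector_weight :: "(int \<Rightarrow> real) \<Rightarrow> bool" where
  "multiplicative_vector_weight w \<longleftrightarrow>
     vector_weight w \<and> w 1 > 0 \<and> (\<forall>j. w j = w 1 powi j)"

definition multiscale_norm ::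
    "(real ^ 'n::finite \<Rightarrow> complex) \<Rightarrow> real \<Rightarrow> real \<Rightarrow> real \<Rightarrow> (int \<Rightarrow> real) \<Rightarrow>
     ((real ^ 'n \<Rightarrow> complex) \<Rightarrow> complex) \<Rightarrow> ennreal" where
  "multiscale_norm \<psi> p q r w f =
     ennpowr (\<Sum>\<^sub>\<infinity>j\<in>UNIV. ennreal (w j powr r) * ennpowr (modulation_norm \<psi> p q j f) r) (1 / r)"

definition multiscale_space ::
    "(real ^ 'n::finite \<Rightarrow> complex) \<Rightarrow> real \<Rightarrow> real \<Rightarrow> real \<Rightarrow> (int \<Rightarrow> real) \<Rightarrow>
     ((real ^ 'n \<Rightarrow> complex) \<Rightarrow> complex) set" where
  "multiscale_space \<psi> p q r w =
     {f \<in> tempered_distributions. multiscale_norm \<psi> p q r w f < \<infinity>}"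


section \<open>Dilations preserve tempered distributions\<close>

lemma partial_scale:
  assumes "g differentiable at (c *\<^sub>R x)"
  shows "partial i (\<lambda>y. a *\<^sub>R g (c *\<^sub>R y)) x = (a * c) *\<^sub>R partial i g (c *\<^sub>R x)"
proof -
  obtain D where D: "(g has_derivative D) (at (c *\<^sub>R x))"
    using assms by (auto simp: differentiable_def)
  then interpret D: bounded_linear D by (rule has_derivative_bounded_linear)
  have "((\<lambda>t. g (c *\<^sub>R x + t *\<^sub>R axis i 1)) has_derivative (\<lambda>t. D (t *\<^sub>R axis i 1))) (at 0)"
    by (rule has_derivative_compose[where f' = "\<lambda>t. t *\<^sub>R axis i 1" and g' = D])
       (auto intro!: derivative_eq_intros simp: D)
  then have 1: "partial i g (c *\<^sub>R x) = D (axis i 1)"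
    unfolding partial_def
    by (intro vector_derivative_at) (simp add: has_vector_derivative_def D.scaleR)
  have "((\<lambda>t. g (c *\<^sub>R (x + t *\<^sub>R axis i 1))) has_derivative (\<lambda>t. D (c *\<^sub>R t *\<^sub>R axis i 1))) (at 0)"
    by (rule has_derivative_compose[where f' = "\<lambda>t. c *\<^sub>R t *\<^sub>R axis i 1" and g' = D])
       (auto intro!: derivative_eq_intros simp: D)
  then have "((\<lambda>t. a *\<^sub>R g (c *\<^sub>R (x + t *\<^sub>R axis i 1))) has_vector_derivative
      (a * c) *\<^sub>R D (axis i 1)) (at 0)"
    unfolding has_vector_derivative_def
    by (rule has_derivative_eq_rhs[OF has_derivative_scaleR_right])
       (simp add: D.scaleR fun_eq_iff mult_ac)
  then show ?thesis
    unfolding 1 by (subst partial_def) (rule vector_derivative_at)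
qed

lemma partials_scale:
  assumes "smooth \<phi>"
  shows "partials bs (\<lambda>y. \<phi> (c *\<^sub>R y)) = (\<lambda>x. (c ^ length bs) *\<^sub>R partials bs \<phi> (c *\<^sub>R x))"
proof (induction bs)
  case Nil
  show ?case by (simp add: partials_def)
next
  case (Cons b bs)
  have "partials bs \<phi> differentiable at (c *\<^sub>R x)" for x
    using assms by (simp add: smooth_def)
  then have "partial b (partials bs (\<lambda>y. \<phi> (c *\<^sub>R y))) =
      (\<lambda>x. (c ^ length bs * c) *\<^sub>R partial b (partials bs \<phi>) (c *\<^sub>R x))"
    unfolding Cons by (intro ext partial_scale)
  then show ?case by (simp add: partials_def mult_ac)
qed

lemma monomial_scale: "monomial \<alpha> (c *\<^sub>R x) = c ^ (\<Sum>i\<in>UNIV. \<alpha> i) * monomial \<alpha> x"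
  by (simp add: monomial_def power_mult_distrib prod.distrib power_sum)

lemma seminorm_term_scale:
  assumes "smooth \<phi>" "c \<noteq> 0"
  shows "monomial \<alpha> x *\<^sub>R partials bs (\<lambda>y. \<phi> (c *\<^sub>R y)) x =
    (c ^ length bs / c ^ (\<Sum>i\<in>UNIV. \<alpha> i)) *\<^sub>R
      (monomial \<alpha> (c *\<^sub>R x) *\<^sub>R partials bs \<phi> (c *\<^sub>R x))"
  using assms by (simp add: partials_scale monomial_scale)

lemma schwartz_scale:
  assumes "\<phi> \<in> schwartz" "c \<noteq> 0"
  shows "(\<lambda>y. \<phi> (c *\<^sub>R y)) \<in> schwartz"
proof -
  have sm: "smooth \<phi>" and bd: "bounded (range (\<lambda>x. monomial \<alpha> x *\<^sub>R partials bs \<phi> x))" for \<alpha> bs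
    using assms by (auto simp: schwartz_def)
  have "partials bs (\<lambda>y. \<phi> (c *\<^sub>R y)) differentiable at x" for bs x
  proof -
    obtain D where "(partials bs \<phi> has_derivative D) (at (c *\<^sub>R x))"
      using sm by (auto simp: smooth_def differentiable_def)
    then have "((\<lambda>y. partials bs \<phi> (c *\<^sub>R y)) has_derivative (\<lambda>h. D (c *\<^sub>R h))) (at x)"
      by (intro has_derivative_compose[where g = "partials bs \<phi>" and f = "\<lambda>y. c *\<^sub>R y"])
         (auto intro!: derivative_eq_intros)
    then show ?thesis
      unfolding partials_scale[OF sm] differentiable_def
      by (intro exI) (rule has_derivative_scaleR_right)
  qed
  moreover have "bounded (range (\<lambda>x. monomial \<alpha> x *\<^sub>R partials bs (\<lambda>y. \<phi> (c *\<^sub>R y)) x))" for \<alpha> bs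
    unfolding seminorm_term_scale[OF sm assms(2)]
    by (rule bounded_subset[OF bounded_scaling[OF bd[of \<alpha> bs]]]) blast
  ultimately show ?thesis by (auto simp: schwartz_def smooth_def)
qed

lemma schwartz_term_le_seminorm:
  assumes "\<phi> \<in> schwartz"
  shows "norm (monomial \<alpha> x *\<^sub>R partials bs \<phi> x) \<le> schwartz_seminorm \<alpha> bs \<phi>"
proof -
  have "bounded (range (\<lambda>x. monomial \<alpha> x *\<^sub>R partials bs \<phi> x))"
    using assms by (auto simp: schwartz_def)
  then have "bdd_above (range (\<lambda>x. norm (monomial \<alpha> x *\<^sub>R partials bs \<phi> x)))"
    unfolding bounded_iff bdd_above_def by blast
  then show ?thesis unfolding schwartz_seminorm_def by (rule cSUP_upper2) auto
qed

lemma schwartz_seminorm_nonneg: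
  assumes "\<phi> \<in> schwartz"
  shows "schwartz_seminorm \<alpha> bs \<phi> \<ge> 0"
  using schwartz_term_le_seminorm[OF assms, of \<alpha> 0 bs] norm_ge_zero order_trans by blast

lemma schwartz_seminorm_scale_le:
  assumes "\<phi> \<in> schwartz" "c \<noteq> 0"
  shows "schwartz_seminorm \<alpha> bs (\<lambda>y. \<phi> (c *\<^sub>R y)) \<le>
    \<bar>c ^ length bs / c ^ (\<Sum>i\<in>UNIV. \<alpha> i)\<bar> * schwartz_seminorm \<alpha> bs \<phi>"
proof -
  have sm: "smooth \<phi>" using assms by (auto simp: schwartz_def)
  show ?thesis
    unfolding schwartz_seminorm_def[of _ _ "\<lambda>y. \<phi> (c *\<^sub>R y)"] seminorm_term_scale[OF sm assms(2)]
    by (subst norm_scaleR)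
       (intro cSUP_least mult_left_mono schwartz_term_le_seminorm assms; simp)
qed

lemma tempered_distributions_dilate:
  fixes f :: "(real ^ 'n::finite \<Rightarrow> complex) \<Rightarrow> complex"
  assumes f: "f \<in> tempered_distributions" and c: "c > 0"
  shows "dilate c f \<in> tempered_distributions"
  unfolding tempered_distributions_def
proof (intro CollectI conjI ballI allI impI)
  fix \<phi> \<eta> :: "real ^ 'n \<Rightarrow> complex" and a b :: complex
  assume "\<phi> \<in> schwartz" "\<eta> \<in> schwartz"
  then have "(\<lambda>y. \<phi> ((1 / c) *\<^sub>R y)) \<in> schwartz" "(\<lambda>y. \<eta> ((1 / c) *\<^sub>R y)) \<in> schwartz"
    using c by (auto intro!: schwartz_scale)
  then show "dilate c f (\<lambda>x. a * \<phi> x + b * \<eta> x) = a * dilate c f \<phi> + b * dilate c f \<eta>"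
    using f by (simp add: tempered_distributions_def dilate_def add_divide_distrib)
next
  fix \<Phi> :: "nat \<Rightarrow> real ^ 'n \<Rightarrow> complex"
  assume S: "range \<Phi> \<subseteq> schwartz" and 0: "\<forall>\<alpha> bs. (\<lambda>n. schwartz_seminorm \<alpha> bs (\<Phi> n)) \<longlonglongrightarrow> 0"
  let ?\<Phi> = "\<lambda>n y. \<Phi> n ((1 / c) *\<^sub>R y)"
  have mem: "\<Phi> n \<in> schwartz" "?\<Phi> n \<in> schwartz" for n
    using S c by (auto intro!: schwartz_scale)
  have "(\<lambda>n. schwartz_seminorm \<alpha> bs (?\<Phi> n)) \<longlonglongrightarrow> 0" for \<alpha> bs
  proof (rule tendsto_sandwich[OF always_eventually always_eventually tendsto_const])
    show "\<forall>n. 0 \<le> schwartz_seminorm \<alpha> bs (?\<Phi> n)"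
      using schwartz_seminorm_nonneg mem by blast
    show "\<forall>n. schwartz_seminorm \<alpha> bs (?\<Phi> n) \<le>
        \<bar>(1 / c) ^ length bs / (1 / c) ^ (\<Sum>i\<in>UNIV. \<alpha> i)\<bar> * schwartz_seminorm \<alpha> bs (\<Phi> n)"
      using c mem by (intro allI schwartz_seminorm_scale_le) auto
    show "(\<lambda>n. \<bar>(1 / c) ^ length bs / (1 / c) ^ (\<Sum>i\<in>UNIV. \<alpha> i)\<bar> *
        schwartz_seminorm \<alpha> bs (\<Phi> n)) \<longlonglongrightarrow> 0"
      using tendsto_mult_right_zero 0 by blast
  qed
  moreover have "range ?\<Phi> \<subseteq> schwartz" using mem by blast
  ultimately have "(\<lambda>n. f (?\<Phi> n)) \<longlonglongrightarrow> 0"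
    using f unfolding tempered_distributions_def by blast
  then have "(\<lambda>n. f (?\<Phi> n) / of_real (c ^ CARD('n))) \<longlonglongrightarrow> 0"
    by (rule tendsto_divide_zero)
  then show "(\<lambda>n. dilate c f (\<Phi> n)) \<longlonglongrightarrow> 0"
    by (simp add: dilate_def)
qed

end

(* A change of variables shows that the block of the dilate at (j, k) is
   x |-> (block of f at (j - j0, k)) (2^j0 x), so the modulation norm of scale j of the dilate is
   l^(-d/p) times that of scale j - j0 of f, and a multiplicative weight turns the shift of j into
   the factor w_j0 = l^(log_2 w_1). The analytic content is that f is linear on Schwartz functions
   only: to pull the Jacobian l^d out of f one needs that the Fourier transform of a smooth
   function of bounded support is Schwartz. *)

theory Submission
  imports Defs
begin

section \<open>Smooth functions\<close>

text \<open>A block is a function of x obtained by applying f to a family of test functions, and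
  nothing here shows it to be measurable in x; its Lebesgue norm is therefore scaled by a
  substitution rule valid for arbitrary functions into [0, \<infinity>]. The norms are manipulated
  in that range, where the sums over k and j always exist and constants pull out of them. Smoothness
  is defined through lists of partial derivatives, so a direct proof for products or compositions
  would need Leibniz and chain rules over lists; classes invariant under \<open>partial\<close> take
  their place. For the Schwartz property, bounded support survives both differentiation and
  multiplication by a coordinate, and the Fourier transform exchanges these two operations up to
  constants. Each seminorm of the transform is thus the supremum of a multiple of another such
  transform, which an L^1 bound controls.\<close>

lemma smooth_differentiable: "smooth \<phi> \<Longrightarrow> \<phi> differentiable at x"
  unfolding smooth_def partials_def by (metis foldr_Nil id_apply)

lemma smooth_partial:
  assumes "smooth \<phi>"
  shows "smooth (partial i \<phi>)"
proof -
  have "partials bs (partial i \<phi>) = partials (bs @ [i]) \<phi>" for bs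
    by (simp add: partials_def)
  with assms show ?thesis by (simp add: smooth_def)
qed

text \<open>The smooth functions form the largest class of differentiable functions closed under
  \<open>partial\<close>, so any one such class containing \<phi> is a certificate.\<close>

lemma smooth_coinduct:
  assumes "P \<phi>" and "\<And>g x. P g \<Longrightarrow> g differentiable at x" and "\<And>g i. P g \<Longrightarrow> P (partial i g)"
  shows "smooth \<phi>"
proof -
  have "P (partials bs \<phi>)" for bs
    by (induction bs) (use assms in \<open>auto simp: partials_def\<close>)
  with assms(2) show ?thesis by (simp add: smooth_def)
qed

lemma partial_eq:
  assumes "(g has_derivative D) (at x)"
  shows "partial i g x = D (axis i 1)"
proof -
  interpret D: bounded_linear D using assms by (rule has_derivative_bounded_linear)
  have "((\<lambda>t. g (x + t *\<^sub>R axis i 1)) has_derivative (\<lambda>t. D (t *\<^sub>R axis i 1))) (at 0)"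
    by (rule has_derivative_compose[where f' = "\<lambda>t. t *\<^sub>R axis i 1" and g' = D])
       (auto intro!: derivative_eq_intros simp: assms)
  then show ?thesis
    unfolding partial_def
    by (intro vector_derivative_at) (simp add: has_vector_derivative_def D.scaleR)
qed

text \<open>The derivative is taken at every t, not only at 0, because the mean value inequality
  along a coordinate line needs it on the whole line.\<close>

lemma has_vector_derivative_partial:
  assumes "g differentiable at (x + t *\<^sub>R axis i 1)"
  shows "((\<lambda>t. g (x + t *\<^sub>R axis i 1)) has_vector_derivative
    partial i g (x + t *\<^sub>R axis i 1)) (at t)"
proof -
  obtain D where D: "(g has_derivative D) (at (x + t *\<^sub>R axis i 1))"
    using assms by (auto simp: differentiable_def)
  then interpret D: bounded_linear D by (rule has_derivative_bounded_linear)
  have "((\<lambda>t. g (x + t *\<^sub>R axis i 1)) has_derivative (\<lambda>t. D (t *\<^sub>R axis i 1))) (at t)"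
    by (rule has_derivative_compose[where f' = "\<lambda>t. t *\<^sub>R axis i 1" and g' = D])
       (auto intro!: derivative_eq_intros simp: D)
  then show ?thesis
    by (simp add: has_vector_derivative_def D.scaleR partial_eq[OF D])
qed

lemma partial_add:
  assumes "f differentiable at x" "g differentiable at x"
  shows "partial i (\<lambda>x. f x + g x) x = partial i f x + partial i g x"
proof -
  obtain D E where D: "(f has_derivative D) (at x)" and E: "(g has_derivative E) (at x)"
    using assms by (auto simp: differentiable_def)
  show ?thesis
    by (simp add: partial_eq[OF D] partial_eq[OF E] partial_eq[OF has_derivative_add[OF D E]])
qed

lemma partial_mult:
  assumes "f differentiable at x" "g differentiable at x"
  shows "partial i (\<lambda>x. f x * g x) x = f x * partial i g x + partial i f x * g x"
proof -
  obtain D E where D: "(f has_derivative D) (at x)" and E: "(g has_derivative E) (at x)"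
    using assms by (auto simp: differentiable_def)
  show ?thesis
    by (simp add: partial_eq[OF D] partial_eq[OF E] partial_eq[OF has_derivative_mult[OF D E]])
qed

text \<open>Single products are not invariant under \<open>partial\<close>: the product rule yields
  a sum of two. Closing under sums gives an invariant class that serves as the certificate for
  products.\<close>

inductive sum_of_smooth_products :: "(real ^ 'n::finite \<Rightarrow> complex) \<Rightarrow> bool" where
  prod: "smooth f \<Longrightarrow> smooth g \<Longrightarrow> sum_of_smooth_products (\<lambda>x. f x * g x)"
| add: "sum_of_smooth_products f \<Longrightarrow> sum_of_smooth_products g \<Longrightarrow>
    sum_of_smooth_products (\<lambda>x. f x + g x)"

lemma smooth_mult:
  assumes "smooth f" "smooth g"
  shows "smooth (\<lambda>x. f x * g x)"
proof (rule smooth_coinduct[of sum_of_smooth_products])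
  show diff: "h differentiable at x" if "sum_of_smooth_products h" for h :: "real ^ 'a \<Rightarrow> complex" and x
    using that by induction (auto intro: differentiable_mult differentiable_add smooth_differentiable)
  show "sum_of_smooth_products (partial i h)" if "sum_of_smooth_products h"
    for h :: "real ^ 'a \<Rightarrow> complex" and i
    using that
  proof induction
    case (prod f g)
    then have "partial i (\<lambda>x. f x * g x) = (\<lambda>x. f x * partial i g x + partial i f x * g x)"
      by (intro ext partial_mult smooth_differentiable)
    with prod show ?case
      by (auto intro!: sum_of_smooth_products.intros smooth_partial)
  next
    case (add f g)
    then have "partial i (\<lambda>x. f x + g x) = (\<lambda>x. partial i f x + partial i g x)"
      by (intro ext partial_add diff)
    with add show ?case by (auto intro!: sum_of_smooth_products.intros)
  qed
qed (use assms in \<open>auto intro: sum_of_smooth_products.intros\<close>)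

lemma smooth_affine:
  fixes L :: "real ^ 'n::finite \<Rightarrow> complex"
  assumes "bounded_linear L"
  shows "smooth (\<lambda>x. L x + c)"
proof (rule smooth_coinduct[of "\<lambda>g. \<exists>L c. bounded_linear L \<and> g = (\<lambda>x. L x + c)"])
  have *: "((\<lambda>x. L x + c) has_derivative L) (at x)" if "bounded_linear L"
    for L :: "real ^ 'n \<Rightarrow> complex" and c x
    using has_derivative_add[OF bounded_linear_imp_has_derivative[OF that] has_derivative_const]
    by (simp add: fun_eq_iff)
  show "g differentiable at x" if "\<exists>L c. bounded_linear L \<and> g = (\<lambda>x. L x + c)"
    for g :: "real ^ 'n \<Rightarrow> complex" and x
    using that * by (auto simp: differentiable_def)
  \<comment> \<open>The derivative of an affine map is constant, hence affine with linear part 0 and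
    constant term its value at the origin.\<close>
  show "\<exists>L c. bounded_linear L \<and> partial i g = (\<lambda>x. L x + c)"
    if "\<exists>L c. bounded_linear L \<and> g = (\<lambda>x. L x + c)" for g :: "real ^ 'n \<Rightarrow> complex" and i
    using that partial_eq[OF *]
    by (intro exI[of _ "\<lambda>x. 0"] exI[of _ "partial i g 0"]) fastforce
qed (use assms in auto)

lemma smooth_exp_linear:
  fixes L :: "real ^ 'n::finite \<Rightarrow> complex"
  assumes "bounded_linear L"
  shows "smooth (\<lambda>x. exp (L x))"
proof (rule smooth_coinduct[of "\<lambda>g. \<exists>c. g = (\<lambda>x. c * exp (L x))"])
  have *: "((\<lambda>x. c * exp (L x)) has_derivative (\<lambda>h. c * (exp (L x) * L h))) (at x)" for c x
    using has_derivative_compose[OF bounded_linear_imp_has_derivative[OF assms]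
        DERIV_exp[unfolded has_field_derivative_def]]
    by (rule has_derivative_mult_right)
  show "g differentiable at x" if "\<exists>c. g = (\<lambda>x. c * exp (L x))" for g x
    using that * by (auto simp: differentiable_def)
  show "\<exists>c. partial i g = (\<lambda>x. c * exp (L x))" if "\<exists>c. g = (\<lambda>x. c * exp (L x))" for g i
  proof -
    from that obtain c where g: "g = (\<lambda>x. c * exp (L x))" by blast
    have "partial i g = (\<lambda>x. c * L (axis i 1) * exp (L x))"
      unfolding g by (simp add: fun_eq_iff partial_eq[OF *])
    then show ?thesis by blast
  qed
qed (auto intro!: exI[of _ 1])

text \<open>Each derivative replaces g by \<open>partial i g\<close> and produces a factor c. The
  invariant therefore lets g range over all smooth functions and carries a multiplier m.\<close>

lemma smooth_compose_affine:
  assumes "smooth g"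
  shows "smooth (\<lambda>x. g (c *\<^sub>R x + a))"
proof (rule smooth_coinduct[of "\<lambda>f. \<exists>m g. smooth g \<and> f = (\<lambda>x. m * g (c *\<^sub>R x + a))"])
  have *: "((\<lambda>x. m * g (c *\<^sub>R x + a)) has_derivative (\<lambda>h. m * D (c *\<^sub>R h))) (at x)"
    if "(g has_derivative D) (at (c *\<^sub>R x + a))" for g :: "real ^ 'a \<Rightarrow> complex" and D m x
    by (rule has_derivative_mult_right,
        rule has_derivative_compose[where f = "\<lambda>x. c *\<^sub>R x + a" and g = g])
       (auto intro!: derivative_eq_intros simp: that)
  show "f differentiable at x" if "\<exists>m g. smooth g \<and> f = (\<lambda>x. m * g (c *\<^sub>R x + a))"
    for f :: "real ^ 'a \<Rightarrow> complex" and x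
  proof -
    from that obtain m g where g: "smooth g" "f = (\<lambda>x. m * g (c *\<^sub>R x + a))" by blast
    from smooth_differentiable[OF g(1)] obtain D where "(g has_derivative D) (at (c *\<^sub>R x + a))"
      by (auto simp: differentiable_def)
    from *[OF this] show ?thesis by (auto simp: differentiable_def g)
  qed
  show "\<exists>m g. smooth g \<and> partial i f = (\<lambda>x. m * g (c *\<^sub>R x + a))"
    if "\<exists>m g. smooth g \<and> f = (\<lambda>x. m * g (c *\<^sub>R x + a))" for f :: "real ^ 'a \<Rightarrow> complex" and i
  proof -
    from that obtain m g where g: "smooth g" "f = (\<lambda>x. m * g (c *\<^sub>R x + a))" by blast
    have "partial i f x = m * of_real c * partial i g (c *\<^sub>R x + a)" for x
    proof -
      from smooth_differentiable[OF g(1)] obtain D where D: "(g has_derivative D) (at (c *\<^sub>R x + a))"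
        by (auto simp: differentiable_def)
      then interpret D: bounded_linear D by (rule has_derivative_bounded_linear)
      show ?thesis
        by (simp only: partial_eq[OF D] partial_eq[OF *[OF D]] g(2) D.scaleR, simp add: scaleR_conv_of_real)
    qed
    then show ?thesis using smooth_partial[OF g(1)] by blast
  qed
qed (use assms in \<open>auto intro!: exI[of _ 1]\<close>)

section \<open>Test functions\<close>

text \<open>Only boundedness of the set of nonzero points is asked for; in finite dimension its
  closure is then compact, so these are the usual compactly supported smooth functions.\<close>

definition test_function :: "(real ^ 'n::finite \<Rightarrow> complex) \<Rightarrow> bool" where
  "test_function \<phi> \<longleftrightarrow> smooth \<phi> \<and> bounded {x. \<phi> x \<noteq> 0}"

lemma test_function_mult:
  assumes "test_function \<phi>" "smooth g"
  shows "test_function (\<lambda>x. \<phi> x * g x)"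
proof -
  have "{x. \<phi> x * g x \<noteq> 0} \<subseteq> {x. \<phi> x \<noteq> 0}" by auto
  from bounded_subset[OF _ this] smooth_mult[of \<phi> g] show ?thesis
    using assms by (simp add: test_function_def)
qed

lemma test_function_compose_affine:
  assumes "test_function \<phi>" "c \<noteq> 0"
  shows "test_function (\<lambda>x. \<phi> (c *\<^sub>R x + a))"
proof -
  have "bounded ((\<lambda>y. (1 / c) *\<^sub>R y) ` ((\<lambda>y. - a + y) ` {y. \<phi> y \<noteq> 0}))"
    using assms by (intro bounded_scaling bounded_translation) (auto simp: test_function_def)
  then have "bounded ((\<lambda>y. (1 / c) *\<^sub>R (y - a)) ` {y. \<phi> y \<noteq> 0})"
    by (simp add: image_image)
  moreover have "{x. \<phi> (c *\<^sub>R x + a) \<noteq> 0} \<subseteq> (\<lambda>y. (1 / c) *\<^sub>R (y - a)) ` {y. \<phi> y \<noteq> 0}"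
  proof
    fix x assume "x \<in> {x. \<phi> (c *\<^sub>R x + a) \<noteq> 0}"
    moreover have "x = (1 / c) *\<^sub>R ((c *\<^sub>R x + a) - a)"
      using assms(2) by simp
    ultimately show "x \<in> (\<lambda>y. (1 / c) *\<^sub>R (y - a)) ` {y. \<phi> y \<noteq> 0}"
      by blast
  qed
  ultimately have "bounded {x. \<phi> (c *\<^sub>R x + a) \<noteq> 0}"
    by (rule bounded_subset)
  then show ?thesis
    using assms(1) smooth_compose_affine[of \<phi> c a] by (simp add: test_function_def)
qed

text \<open>Off the closure, \<phi> vanishes on an open neighbourhood. The closure matters: at a
  mere zero of \<phi> the derivative can be nonzero.\<close>

lemma partial_eq_0_outside:
  assumes "x \<notin> closure {x. \<phi> x \<noteq> 0}"
  shows "partial i \<phi> x = 0"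
proof -
  let ?S = "- closure {x. \<phi> x \<noteq> 0}"
  have zero: "\<phi> y = 0" if "y \<in> ?S" for y
    using that closure_subset[of "{x. \<phi> x \<noteq> 0}"] by blast
  have "(\<phi> has_derivative (\<lambda>_. 0)) (at x)"
  proof (rule has_derivative_transform_within_open[of "\<lambda>_. 0" _ _ UNIV ?S])
    show "open ?S" by (rule open_Compl[OF closed_closure])
    show "x \<in> ?S" using assms by blast
    show "0 = \<phi> y" if "y \<in> ?S" for y using zero[OF that] by (rule sym)
  qed simp
  then show ?thesis by (simp add: partial_eq)
qed

lemma test_function_partial:
  assumes "test_function \<phi>"
  shows "test_function (partial i \<phi>)"
proof -
  have "{x. partial i \<phi> x \<noteq> 0} \<subseteq> closure {x. \<phi> x \<noteq> 0}"
    using partial_eq_0_outside by auto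
  with assms show ?thesis
    unfolding test_function_def by (auto intro: smooth_partial bounded_subset[OF bounded_closure])
qed

lemma test_function_continuous: "test_function \<phi> \<Longrightarrow> continuous_on A \<phi>"
  unfolding test_function_def
  by (intro continuous_at_imp_continuous_on ballI differentiable_imp_continuous_within smooth_differentiable) simp

section \<open>Integrability and boundedness of test functions\<close>

lemma integrable_continuous_bounded_support:
  fixes g :: "'a::euclidean_space \<Rightarrow> 'b::{banach, second_countable_topology}"
  assumes "continuous_on UNIV g" "bounded {x. g x \<noteq> 0}"
  shows "integrable lborel g"
proof -
  obtain B where B: "\<And>x. g x \<noteq> 0 \<Longrightarrow> x \<in> cball 0 B"
    using assms(2) by (auto simp: bounded_iff)
  have "integrable lborel (\<lambda>x. indicator (cball 0 B) x *\<^sub>R g x)"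
    using assms(1) by (intro borel_integrable_compact) (auto intro: continuous_on_subset)
  also have "(\<lambda>x. indicator (cball 0 B) x *\<^sub>R g x) = g"
    using B by (auto simp: fun_eq_iff indicator_def)
  finally show ?thesis .
qed

lemma test_function_integrable_mult:
  assumes "test_function \<phi>" "continuous_on UNIV g"
  shows "integrable lborel (\<lambda>x. \<phi> x * g x)"
proof (rule integrable_continuous_bounded_support)
  have "{x. \<phi> x * g x \<noteq> 0} \<subseteq> {x. \<phi> x \<noteq> 0}" by auto
  then show "bounded {x. \<phi> x * g x \<noteq> 0}"
    by (rule bounded_subset[rotated]) (use assms(1) in \<open>simp add: test_function_def\<close>)
  show "continuous_on UNIV (\<lambda>x. \<phi> x * g x)"
    by (rule continuous_on_mult[OF test_function_continuous[OF assms(1)] assms(2)])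
qed

lemma test_function_bounded:
  assumes "test_function \<phi>"
  obtains B where "B \<ge> 0" "\<And>x. norm (\<phi> x) \<le> B"
proof -
  have "compact (\<phi> ` closure {x. \<phi> x \<noteq> 0})"
    using assms test_function_continuous
    by (intro compact_continuous_image) (auto simp: test_function_def compact_closure)
  then obtain B where "\<And>x. x \<in> closure {x. \<phi> x \<noteq> 0} \<Longrightarrow> norm (\<phi> x) \<le> B"
    using compact_imp_bounded by (fastforce simp: bounded_iff)
  then have "norm (\<phi> x) \<le> max 0 B" for x
    using closure_subset[of "{x. \<phi> x \<noteq> 0}"] by (cases "\<phi> x = 0") (auto simp: le_max_iff_disj)
  then show ?thesis using that[of "max 0 B"] by auto
qed

section \<open>Changes of variables\<close>

lemma integral_lborel_affine:
  fixes g :: "'a::euclidean_space \<Rightarrow> 'b::{banach, second_countable_topology}"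
  assumes "c \<noteq> 0" and [measurable]: "g \<in> borel_measurable borel"
  shows "(\<integral>x. g x \<partial>lborel) = \<bar>c\<bar> ^ DIM('a) *\<^sub>R (\<integral>x. g (a + c *\<^sub>R x) \<partial>lborel)"
  by (subst lborel_affine[OF assms(1), of a], subst integral_density)
     (auto simp: integral_distr)

text \<open>As \<open>g\<close> need not be measurable, this is not an instance of \<open>nn_integral_distr\<close>: scaling the
  simple functions below \<open>g\<close> gives one inequality, and the other one is that inequality
  for \<open>1 / c\<close>.\<close>

lemma nn_integral_lborel_scale:
  fixes g :: "'a::euclidean_space \<Rightarrow> ennreal"
  assumes "c > 0"
  shows "(\<integral>\<^sup>+x. g x \<partial>lborel) = ennreal (c ^ DIM('a)) * (\<integral>\<^sup>+x. g (c *\<^sub>R x) \<partial>lborel)"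
proof -
  have le: "(\<integral>\<^sup>+x. g x \<partial>lborel) \<le> ennreal (c ^ DIM('a)) * (\<integral>\<^sup>+x. g (c *\<^sub>R x) \<partial>lborel)"
    if "c > 0" for g :: "'a \<Rightarrow> ennreal" and c :: real
    unfolding nn_integral_def[of lborel g]
  proof (intro SUP_least, clarify)
    fix s :: "'a \<Rightarrow> ennreal" assume s: "simple_function lborel s" "s \<le> g"
    have [measurable]: "s \<in> borel_measurable borel"
      using borel_measurable_simple_function[OF s(1)] by simp
    have "integral\<^sup>S lborel s = (\<integral>\<^sup>+x. s x \<partial>lborel)"
      using s(1) by (simp add: nn_integral_eq_simple_integral)
    also have "\<dots> = ennreal (c ^ DIM('a)) * (\<integral>\<^sup>+x. s (c *\<^sub>R x) \<partial>lborel)"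
      by (subst lborel_affine[of c 0])
         (use that in \<open>simp_all add: nn_integral_density nn_integral_distr nn_integral_cmult\<close>)
    also have "\<dots> \<le> ennreal (c ^ DIM('a)) * (\<integral>\<^sup>+x. g (c *\<^sub>R x) \<partial>lborel)"
      using s(2) by (intro mult_left_mono nn_integral_mono) (simp_all add: le_fun_def)
    finally show "integral\<^sup>S lborel s \<le> ennreal (c ^ DIM('a)) * (\<integral>\<^sup>+x. g (c *\<^sub>R x) \<partial>lborel)" .
  qed
  have "ennreal (c ^ DIM('a)) * (\<integral>\<^sup>+x. g (c *\<^sub>R x) \<partial>lborel) \<le>
      ennreal (c ^ DIM('a)) * (ennreal ((1 / c) ^ DIM('a)) * (\<integral>\<^sup>+x. g x \<partial>lborel))"
    using le[of "1 / c" "\<lambda>x. g (c *\<^sub>R x)"] assms by (intro mult_left_mono) auto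
  also have "\<dots> = (\<integral>\<^sup>+x. g x \<partial>lborel)"
  proof -
    have "ennreal (c ^ DIM('a)) * ennreal ((1 / c) ^ DIM('a)) = 1"
      using assms by (simp add: power_divide flip: ennreal_mult)
    then show ?thesis by (simp only: mult.assoc[symmetric] mult_1)
  qed
  finally show ?thesis using le[OF assms] by (intro antisym)
qed

section \<open>The Fourier transform of a test function\<close>

lemma continuous_on_phase: "continuous_on A (\<lambda>\<xi>::real ^ 'n::finite. exp (- 2 * pi * \<i> * (\<xi> \<bullet> y)))"
  by (intro continuous_intros)

lemma smooth_phase: "smooth (\<lambda>\<xi>::real ^ 'n::finite. exp (2 * pi * \<i> * (x \<bullet> \<xi>)))"
  by (intro smooth_exp_linear bounded_linear_compose[OF bounded_linear_mult_right
      bounded_linear_compose[OF bounded_linear_of_real bounded_linear_inner_right]])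

lemma smooth_coordinate: "smooth (\<lambda>\<xi>::real ^ 'n::finite. - 2 * pi * \<i> * (\<xi> $ i))"
  using smooth_affine[OF bounded_linear_compose[OF bounded_linear_mult_right
      bounded_linear_compose[OF bounded_linear_of_real bounded_linear_vec_nth]], of "- 2 * pi * \<i>" i 0]
  by simp

text \<open>The first-order expansion of the phase leaves a remainder of at most K times the square
  of the norm of h, where K is a second moment of \<phi>, finite by bounded support. This gives the
  total derivative that \<open>smooth\<close> demands, with an explicit error in place of a limit
  under the integral.\<close>

lemma fourier_has_derivative:
  fixes \<phi> :: "real ^ 'n::finite \<Rightarrow> complex"
  assumes \<phi>: "test_function \<phi>"
  shows "(fourier \<phi> has_derivative
    (\<lambda>h. \<Sum>i\<in>UNIV. (h $ i) *\<^sub>R fourier (\<lambda>\<xi>. \<phi> \<xi> * (- 2 * pi * \<i> * (\<xi> $ i))) y)) (at y)"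
    (is "(_ has_derivative ?D) _")
proof (rule has_derivativeI_sandwich[where e = 1])
  define K where "K = (\<integral>\<xi>. norm (\<phi> \<xi>) * (2 * pi * norm \<xi>)\<^sup>2 \<partial>lborel)"
  let ?e = "\<lambda>y \<xi>. exp (- 2 * pi * \<i> * (\<xi> \<bullet> y)) :: complex"
  have int: "integrable lborel (\<lambda>\<xi>. \<phi> \<xi> * ?e y \<xi>)" for y
    by (intro test_function_integrable_mult \<phi> continuous_on_phase)
  have int1: "integrable lborel (\<lambda>\<xi>. \<phi> \<xi> * ((- 2 * pi * \<i> * (\<xi> \<bullet> h)) * ?e y \<xi>))" for h
    by (intro test_function_integrable_mult \<phi> continuous_intros)
  have int2: "integrable lborel (\<lambda>\<xi>. (h $ i) *\<^sub>R (\<phi> \<xi> * (- 2 * pi * \<i> * (\<xi> $ i)) * ?e y \<xi>))" for h :: "real ^ 'n" and i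
    unfolding mult.assoc[of "\<phi> _"]
    by (intro integrable_scaleR_right test_function_integrable_mult \<phi> continuous_intros)
  have intK: "integrable lborel (\<lambda>\<xi>. norm (\<phi> \<xi>) * (2 * pi * norm \<xi>)\<^sup>2)"
  proof -
    have "integrable lborel (\<lambda>\<xi>. \<phi> \<xi> * of_real ((2 * pi * norm \<xi>)\<^sup>2))"
      by (intro test_function_integrable_mult \<phi> continuous_intros)
    from integrable_norm[OF this] show ?thesis by (simp add: norm_mult norm_power)
  qed
  \<comment> \<open>Summed over the coordinates, the derivative becomes one integral against the
    inner product of \<xi> and h, which is the linear term in the expansion of the phase.\<close>
  have D: "?D h = (\<integral>\<xi>. \<phi> \<xi> * ((- 2 * pi * \<i> * (\<xi> \<bullet> h)) * ?e y \<xi>) \<partial>lborel)" for h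
  proof -
    have "?D h = (\<integral>\<xi>. (\<Sum>i\<in>UNIV. (h $ i) *\<^sub>R (\<phi> \<xi> * (- 2 * pi * \<i> * (\<xi> $ i)) * ?e y \<xi>)) \<partial>lborel)"
      unfolding fourier_def integral_scaleR_right[symmetric]
      by (rule Bochner_Integration.integral_sum[symmetric]) (rule int2)
    also have "\<dots> = (\<integral>\<xi>. \<phi> \<xi> * ((- 2 * pi * \<i> * (\<xi> \<bullet> h)) * ?e y \<xi>) \<partial>lborel)"
      by (intro Bochner_Integration.integral_cong)
         (auto simp: inner_vec_def scaleR_conv_of_real sum_distrib_left sum_distrib_right mult_ac)
    finally show ?thesis .
  qed
  \<comment> \<open>Taylor's bound carries a factor exp |Re z|, which is 1 on the imaginary
    axis.\<close>
  have rem: "norm (exp z - 1 - z) \<le> (norm z)\<^sup>2" if "Re z = 0" for z :: complex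
    using Taylor_exp[of z 1] that by (simp add: algebra_simps power2_eq_square)
  have bound: "norm (fourier \<phi> (y + h) - fourier \<phi> y - ?D h) \<le> K * (norm h)\<^sup>2" for h
  proof -
    let ?r = "\<lambda>\<xi>. \<phi> \<xi> * ?e (y + h) \<xi> - \<phi> \<xi> * ?e y \<xi> -
      \<phi> \<xi> * ((- 2 * pi * \<i> * (\<xi> \<bullet> h)) * ?e y \<xi>)"
    have eq: "fourier \<phi> (y + h) - fourier \<phi> y - ?D h = (\<integral>\<xi>. ?r \<xi> \<partial>lborel)"
      unfolding D unfolding fourier_def
      by (simp only: Bochner_Integration.integral_diff Bochner_Integration.integrable_diff int int1)
    have "norm (\<integral>\<xi>. ?r \<xi> \<partial>lborel) \<le> (\<integral>\<xi>. norm (\<phi> \<xi>) * (2 * pi * norm \<xi>)\<^sup>2 * (norm h)\<^sup>2 \<partial>lborel)"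
    proof (rule Bochner_Integration.integral_norm_bound_integral)
      fix \<xi> :: "real ^ 'n"
      let ?z = "- 2 * pi * \<i> * (\<xi> \<bullet> h) :: complex"
      have "\<phi> \<xi> * ?e (y + h) \<xi> - \<phi> \<xi> * ?e y \<xi> - \<phi> \<xi> * (?z * ?e y \<xi>) = \<phi> \<xi> * ?e y \<xi> * (exp ?z - 1 - ?z)"
      proof -
        have "- 2 * pi * \<i> * (\<xi> \<bullet> (y + h)) = - 2 * pi * \<i> * (\<xi> \<bullet> y) + ?z"
          by (simp add: inner_add_right algebra_simps)
        then have "?e (y + h) \<xi> = ?e y \<xi> * exp ?z"
          by (simp only: exp_add)
        moreover have "a * (e * u) - a * e - a * (z * e) = a * e * (u - 1 - z)" for a e u z :: complex
          by (simp add: algebra_simps)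
        ultimately show ?thesis by (simp only:)
      qed
      then have "norm (\<phi> \<xi> * ?e (y + h) \<xi> - \<phi> \<xi> * ?e y \<xi> - \<phi> \<xi> * (?z * ?e y \<xi>)) =
          norm (\<phi> \<xi>) * norm (exp ?z - 1 - ?z)"
        by (simp add: norm_mult)
      also have "\<dots> \<le> norm (\<phi> \<xi>) * (norm ?z)\<^sup>2"
        by (intro mult_left_mono rem) auto
      also have "norm ?z = 2 * pi * \<bar>\<xi> \<bullet> h\<bar>"
        by (simp add: norm_mult)
      also have "norm (\<phi> \<xi>) * (2 * pi * \<bar>\<xi> \<bullet> h\<bar>)\<^sup>2 \<le> norm (\<phi> \<xi>) * (2 * pi * (norm \<xi> * norm h))\<^sup>2"
        by (intro mult_left_mono power_mono Cauchy_Schwarz_ineq2) auto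
      also have "\<dots> = norm (\<phi> \<xi>) * (2 * pi * norm \<xi>)\<^sup>2 * (norm h)\<^sup>2"
        by (simp add: power_mult_distrib)
      finally show "norm (\<phi> \<xi> * ?e (y + h) \<xi> - \<phi> \<xi> * ?e y \<xi> - \<phi> \<xi> * (?z * ?e y \<xi>)) \<le> \<dots>" .
    next
      show "integrable lborel ?r"
        by (rule Bochner_Integration.integrable_diff[OF Bochner_Integration.integrable_diff[OF int int] int1])
      show "integrable lborel (\<lambda>\<xi>. norm (\<phi> \<xi>) * (2 * pi * norm \<xi>)\<^sup>2 * (norm h)\<^sup>2)"
        by (rule integrable_mult_left[OF intK])
    qed
    also have "\<dots> = K * (norm h)\<^sup>2" by (simp add: K_def)
    finally show ?thesis unfolding eq .
  qed
  show "bounded_linear ?D"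
    by (intro bounded_linear_sum bounded_linear_compose[OF bounded_linear_scaleR_left bounded_linear_vec_nth])
  show "norm (fourier \<phi> z - fourier \<phi> y - ?D (z - y)) / norm (z - y) \<le> K * norm (z - y)"
    if "z \<noteq> y" for z
    using bound[of "z - y"] that by (simp add: divide_le_eq power2_eq_square mult_ac)
  show "((\<lambda>z. K * norm (z - y)) \<longlongrightarrow> 0) (at y)"
    by (intro tendsto_eq_intros) auto
qed simp

lemma partial_fourier:
  assumes "test_function \<phi>"
  shows "partial i (fourier \<phi>) = fourier (\<lambda>\<xi>. \<phi> \<xi> * (- 2 * pi * \<i> * (\<xi> $ i)))"
proof
  fix y
  show "partial i (fourier \<phi>) y = fourier (\<lambda>\<xi>. \<phi> \<xi> * (- 2 * pi * \<i> * (\<xi> $ i))) y"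
    by (simp add: partial_eq[OF fourier_has_derivative[OF assms]] axis_def if_distrib[of "\<lambda>c. c *\<^sub>R _"] cong: if_cong)
qed

text \<open>Each derivative puts a polynomial factor on the frequency side, and that factor is
  absorbed into \<rho>. Its formula is left hidden, since boundedness holds for every
  transform.\<close>

lemma partials_fourier:
  assumes "test_function \<phi>"
  shows "\<exists>\<rho>. test_function \<rho> \<and> partials bs (fourier \<phi>) = fourier \<rho>"
proof (induction bs)
  case Nil
  then show ?case using assms by (auto simp: partials_def)
next
  case (Cons b bs)
  then obtain \<rho> where \<rho>: "test_function \<rho>" "partials bs (fourier \<phi>) = fourier \<rho>" by blast
  then have "partials (b # bs) (fourier \<phi>) = fourier (\<lambda>\<xi>. \<rho> \<xi> * (- 2 * pi * \<i> * (\<xi> $ b)))"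
    by (simp add: partials_def partial_fourier)
  then show ?case using test_function_mult[OF \<rho>(1) smooth_coordinate] by blast
qed

text \<open>Integration by parts, obtained by differentiating the Fourier transform of the
  translates \<open>\<lambda>\<xi>. \<phi> (\<xi> + t *\<^sub>R axis i 1)\<close> at \<open>t = 0\<close>.\<close>

lemma fourier_partial:
  fixes \<phi> :: "real ^ 'n::finite \<Rightarrow> complex"
  assumes \<phi>: "test_function \<phi>"
  shows "fourier (partial i \<phi>) y = 2 * pi * \<i> * (y $ i) * fourier \<phi> y"
proof -
  let ?e = "\<lambda>\<xi>. exp (- 2 * pi * \<i> * (\<xi> \<bullet> y)) :: complex"
  \<comment> \<open>A sequence is used because dominated convergence is sequential; the bound
    \<open>t n\<close> \<le> 1 keeps the supports of all translates in one ball.\<close>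
  define t where "t n = inverse (real (Suc n))" for n
  have t: "t n > 0" "t n \<le> 1" for n by (auto simp: t_def field_simps)
  have t0: "t \<longlonglongrightarrow> 0" unfolding t_def by (rule LIMSEQ_inverse_real_of_nat)
  have tat: "filterlim t (at 0) sequentially"
    using t0 t(1) by (auto simp: filterlim_at intro!: always_eventually) (metis less_irrefl)
  \<comment> \<open>The integral of \<open>s n\<close> is evaluated twice: its limit is the
    transform of the derivative, while a translation of variables gives it in closed form.\<close>
  define s where "s n \<xi> = ((\<phi> (\<xi> + t n *\<^sub>R axis i 1) - \<phi> \<xi>) /\<^sub>R t n) * ?e \<xi>" for n \<xi>
  have [measurable]: "\<phi> \<in> borel_measurable borel" "partial i \<phi> \<in> borel_measurable borel"
    using \<phi> by (auto intro!: borel_measurable_continuous_onI test_function_continuous test_function_partial)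
  have diff: "\<phi> differentiable at x" for x
    using \<phi> smooth_differentiable by (auto simp: test_function_def)
  obtain B where B: "B \<ge> 0" "\<And>x. norm (partial i \<phi> x) \<le> B"
    using test_function_bounded[OF test_function_partial[OF \<phi>]] by blast
  obtain R where R: "\<And>x. \<phi> x \<noteq> 0 \<Longrightarrow> norm x \<le> R"
    using \<phi> by (auto simp: test_function_def bounded_iff)
  have lim: "(\<lambda>n. integral\<^sup>L lborel (s n)) \<longlonglongrightarrow> (\<integral>\<xi>. partial i \<phi> \<xi> * ?e \<xi> \<partial>lborel)"
  proof (rule integral_dominated_convergence[where w = "\<lambda>\<xi>. indicator (cball 0 (R + 1)) \<xi> *\<^sub>R B"])
    show "integrable lborel (\<lambda>\<xi>. indicator (cball 0 (R + 1)) \<xi> *\<^sub>R B :: real)"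
      by (intro borel_integrable_compact) auto
    show "AE \<xi> in lborel. (\<lambda>n. s n \<xi>) \<longlonglongrightarrow> partial i \<phi> \<xi> * ?e \<xi>"
    proof (rule AE_I2)
      fix \<xi>
      have "((\<lambda>t. (\<phi> (\<xi> + t *\<^sub>R axis i 1) - \<phi> \<xi>) /\<^sub>R t) \<longlongrightarrow> partial i \<phi> \<xi>) (at 0)"
      proof -
        let ?q = "\<lambda>t. (\<phi> (\<xi> + t *\<^sub>R axis i 1) - \<phi> \<xi>) /\<^sub>R t - partial i \<phi> \<xi>"
        have "((\<lambda>t. norm (\<phi> (\<xi> + t *\<^sub>R axis i 1) - \<phi> \<xi> - t *\<^sub>R partial i \<phi> \<xi>) / norm t) \<longlongrightarrow> 0) (at 0)"
          using has_vector_derivative_partial[where t = 0 and x = \<xi> and i = i, OF diff]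
          by (simp add: has_vector_derivative_def has_derivative_at)
        moreover have "norm (\<phi> (\<xi> + t *\<^sub>R axis i 1) - \<phi> \<xi> - t *\<^sub>R partial i \<phi> \<xi>) / norm t = norm (?q t)"
          if "t \<noteq> 0" for t
        proof -
          have "\<phi> (\<xi> + t *\<^sub>R axis i 1) - \<phi> \<xi> - t *\<^sub>R partial i \<phi> \<xi> = t *\<^sub>R ?q t"
            using that by (simp add: scaleR_diff_right)
          then show ?thesis using that by simp
        qed
        ultimately have "((\<lambda>t. norm (?q t)) \<longlongrightarrow> 0) (at 0)"
          using Lim_transform_eventually by (force simp: eventually_at_filter)
        then show ?thesis by (simp add: tendsto_norm_zero_iff LIM_zero_iff)
      qed
      then have "(\<lambda>n. (\<phi> (\<xi> + t n *\<^sub>R axis i 1) - \<phi> \<xi>) /\<^sub>R t n) \<longlonglongrightarrow> partial i \<phi> \<xi>"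
        using tat by (rule filterlim_compose)
      then show "(\<lambda>n. s n \<xi>) \<longlonglongrightarrow> partial i \<phi> \<xi> * ?e \<xi>"
        unfolding s_def by (intro tendsto_intros)
    qed
    fix n
    show "AE \<xi> in lborel. norm (s n \<xi>) \<le> indicator (cball 0 (R + 1)) \<xi> *\<^sub>R B"
    proof (rule AE_I2)
      fix \<xi>
      show "norm (s n \<xi>) \<le> indicator (cball 0 (R + 1)) \<xi> *\<^sub>R B"
      proof (cases "\<xi> \<in> cball 0 (R + 1)")
        case True
        \<comment> \<open>The mean value inequality gives a bound proportional to
          \<open>t n\<close>, so the quotient is bounded by B uniformly in n.\<close>
        have "norm (\<phi> (\<xi> + t n *\<^sub>R axis i 1) - \<phi> (\<xi> + 0 *\<^sub>R axis i 1)) \<le> B * norm (t n - 0)"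
          by (rule differentiable_bound[of "UNIV" _ "\<lambda>u h. h *\<^sub>R partial i \<phi> (\<xi> + u *\<^sub>R axis i 1)"])
             (use has_vector_derivative_partial[where i = i, OF diff] B
              in \<open>auto simp: has_vector_derivative_def mult.commute[of B] intro!: onorm_le mult_left_mono\<close>)
        then show ?thesis using True t[of n]
          by (simp add: s_def norm_mult divide_simps)
      next
        case False
        \<comment> \<open>Outside radius R + 1 a shift of length at most 1 cannot reach the ball of
          radius R, so both terms of the quotient vanish.\<close>
        have "norm \<xi> \<le> norm (\<xi> + t n *\<^sub>R axis i 1) + norm (t n *\<^sub>R axis i (1::real) :: real ^ 'n)"
          using norm_diff_ineq[of \<xi> "t n *\<^sub>R axis i (1::real)"] by linarith
        also have "norm (t n *\<^sub>R axis i (1::real) :: real ^ 'n) \<le> 1"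
          using t[of n] by (simp add: norm_axis_1)
        finally have "\<phi> (\<xi> + t n *\<^sub>R axis i 1) = 0" "\<phi> \<xi> = 0"
          using False R[of \<xi>] R[of "\<xi> + t n *\<^sub>R axis i 1"] by auto
        then show ?thesis using False by (simp add: s_def)
      qed
    qed
  qed (unfold s_def, measurable)
  \<comment> \<open>Translation of \<phi> multiplies its transform by a phase, so what remains is
    the difference quotient at 0 of an exponential.\<close>
  have eq: "integral\<^sup>L lborel (s n) = ((exp (2 * pi * \<i> * (y $ i) * t n) - 1) / t n) * fourier \<phi> y" for n
  proof -
    let ?a = "t n *\<^sub>R axis i 1 :: real ^ 'n"
    have int: "integrable lborel (\<lambda>\<xi>. \<phi> \<xi> * ?e \<xi>)"
      by (intro test_function_integrable_mult \<phi> continuous_on_phase)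
    have int_a: "integrable lborel (\<lambda>\<xi>. \<phi> (\<xi> + ?a) * ?e \<xi>)"
      using test_function_compose_affine[OF \<phi>, of 1 ?a]
      by (intro test_function_integrable_mult continuous_on_phase) auto
    let ?c = "2 * pi * \<i> * (y $ i) * t n :: complex"
    have shift: "\<phi> (?a + \<xi>) * ?e (?a + \<xi>) = exp (- ?c) * (\<phi> (\<xi> + ?a) * ?e \<xi>)" for \<xi>
    proof -
      have "- 2 * pi * \<i> * ((?a + \<xi>) \<bullet> y) = - ?c + - 2 * pi * \<i> * (\<xi> \<bullet> y)"
        by (simp add: inner_add_left inner_axis' algebra_simps)
      then have "?e (?a + \<xi>) = exp (- ?c) * ?e \<xi>"
        by (simp only: exp_add)
      then show ?thesis by (simp only: add.commute[of ?a] mult.left_commute)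
    qed
    have "fourier \<phi> y = (\<integral>\<xi>. \<phi> (?a + \<xi>) * ?e (?a + \<xi>) \<partial>lborel)"
      unfolding fourier_def by (subst integral_lborel_affine[of 1 _ ?a]) simp_all
    also have "\<dots> = exp (- ?c) * (\<integral>\<xi>. \<phi> (\<xi> + ?a) * ?e \<xi> \<partial>lborel)"
      unfolding shift by (rule integral_mult_right_zero)
    finally have "exp ?c * fourier \<phi> y = (\<integral>\<xi>. \<phi> (\<xi> + ?a) * ?e \<xi> \<partial>lborel)"
      by (simp only: mult.assoc[symmetric] exp_add[symmetric]) simp
    moreover have "s n = (\<lambda>\<xi>. (\<phi> (\<xi> + ?a) * ?e \<xi> - \<phi> \<xi> * ?e \<xi>) /\<^sub>R t n)"
      unfolding s_def mult_scaleR_left left_diff_distrib ..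
    ultimately have "integral\<^sup>L lborel (s n) = (exp ?c * fourier \<phi> y - fourier \<phi> y) /\<^sub>R t n"
      using int int_a by (simp only: fourier_def[of \<phi>] integral_scaleR_right Bochner_Integration.integral_diff)
    also have "\<dots> = ((exp ?c - 1) / t n) * fourier \<phi> y"
      by (simp add: scaleR_conv_of_real divide_inverse left_diff_distrib right_diff_distrib)
    finally show ?thesis .
  qed
  have "((\<lambda>u. (exp (2 * pi * \<i> * (y $ i) * u) - 1) / u) \<longlongrightarrow> 2 * pi * \<i> * (y $ i)) (at 0)"
    (is "(?f \<longlongrightarrow> ?c) _")
  proof -
    have "((\<lambda>u. exp (?c * u)) has_field_derivative ?c) (at 0)"
      by (auto intro!: derivative_eq_intros)
    then show ?thesis by (simp add: has_field_derivative_iff)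
  qed
  moreover have "filterlim (\<lambda>n. complex_of_real (t n)) (at 0) sequentially"
    using tendsto_of_real[OF t0, where 'a = complex] t(1)
    by (auto simp: filterlim_at intro!: always_eventually) (metis less_irrefl)
  ultimately have "(\<lambda>n. ?f (t n)) \<longlonglongrightarrow> ?c"
    by (rule filterlim_compose)
  then have "(\<lambda>n. ?f (t n) * fourier \<phi> y) \<longlonglongrightarrow> ?c * fourier \<phi> y"
    by (intro tendsto_intros)
  with lim show ?thesis
    unfolding eq fourier_def[of "partial i \<phi>"] by (rule LIMSEQ_unique)
qed

section \<open>Decay of the transform\<close>

text \<open>Each factor \<open>y $ i\<close> is traded for a partial derivative of the test function
  and a factor 1 / (2 \<pi> i). Keeping the constant c outside the transform avoids any appeal to
  linearity of \<open>fourier\<close>.\<close>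

lemma monomial_fourier:
  fixes \<phi> :: "real ^ 'n::finite \<Rightarrow> complex"
  assumes "test_function \<phi>"
  shows "\<exists>\<rho> c. test_function \<rho> \<and> (\<forall>y. monomial \<alpha> y *\<^sub>R fourier \<phi> y = c * fourier \<rho> y)"
proof -
  have step: "\<exists>\<rho> c. test_function \<rho> \<and> (\<forall>y. (y $ i) ^ m *\<^sub>R fourier \<phi> y = c * fourier \<rho> y)"
    if "test_function \<phi>" for \<phi> :: "real ^ 'n \<Rightarrow> complex" and i m
  proof (induction m)
    case 0
    then show ?case using that by (auto intro!: exI[of _ \<phi>] exI[of _ 1])
  next
    case (Suc m)
    then obtain \<rho> c where \<rho>: "test_function \<rho>" "\<And>y. (y $ i) ^ m *\<^sub>R fourier \<phi> y = c * fourier \<rho> y"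
      by blast
    have "(y $ i) ^ Suc m *\<^sub>R fourier \<phi> y = c / (2 * pi * \<i>) * fourier (partial i \<rho>) y" for y
      using \<rho>(2)[of y] by (simp add: fourier_partial[OF \<rho>(1)] scaleR_conv_of_real mult_ac)
    then show ?case using test_function_partial[OF \<rho>(1)] by blast
  qed
  have "\<exists>\<rho> c. test_function \<rho> \<and> (\<forall>y. (\<Prod>i\<in>A. (y $ i) ^ \<alpha> i) *\<^sub>R fourier \<phi> y = c * fourier \<rho> y)"
    if "finite A" for A
    using that
  proof induction
    case empty
    then show ?case using assms by (auto intro!: exI[of _ \<phi>] exI[of _ 1])
  next
    case (insert j A)
    then obtain \<rho> c where \<rho>: "test_function \<rho>"
        "\<And>y. (\<Prod>i\<in>A. (y $ i) ^ \<alpha> i) *\<^sub>R fourier \<phi> y = c * fourier \<rho> y"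
      by blast
    obtain \<eta> d where \<eta>: "test_function \<eta>" "\<And>y. (y $ j) ^ \<alpha> j *\<^sub>R fourier \<rho> y = d * fourier \<eta> y"
      using step[OF \<rho>(1)] by blast
    have "(\<Prod>i\<in>insert j A. (y $ i) ^ \<alpha> i) *\<^sub>R fourier \<phi> y = c * d * fourier \<eta> y" for y
          proof -
      have "(\<Prod>i\<in>insert j A. (y $ i) ^ \<alpha> i) *\<^sub>R fourier \<phi> y =
          (y $ j) ^ \<alpha> j *\<^sub>R (\<Prod>i\<in>A. (y $ i) ^ \<alpha> i) *\<^sub>R fourier \<phi> y"
        using insert(1,2) by simp
      also have "\<dots> = c * ((y $ j) ^ \<alpha> j *\<^sub>R fourier \<rho> y)"
        by (simp only: \<rho>(2) mult_scaleR_right)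
      also have "\<dots> = c * d * fourier \<eta> y"
        by (simp only: \<eta>(2) mult.assoc)
      finally show ?thesis .
    qed
    then show ?case using \<eta>(1) by blast
  qed
  then show ?thesis by (simp add: monomial_def)
qed

text \<open>The phase has modulus 1, so the L^1 bound applies. It is valid for every \<phi>: a
  Bochner integral that does not exist is 0 by convention, and the right-hand side is
  nonnegative.\<close>

lemma bounded_fourier: "bounded (range (fourier \<phi>))"
proof (rule boundedI)
  fix z assume "z \<in> range (fourier \<phi>)"
  then obtain y where "z = fourier \<phi> y" by blast
  then show "norm z \<le> (\<integral>x. norm (\<phi> x) \<partial>lborel)"
    using integral_norm_bound[of lborel "\<lambda>x. \<phi> x * exp (- 2 * pi * \<i> * (x \<bullet> y))"]
    by (simp add: fourier_def norm_mult)
qed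

lemma fourier_test_function_schwartz:
  assumes "test_function \<phi>"
  shows "fourier \<phi> \<in> schwartz"
proof -
  have "smooth (fourier \<phi>)"
    unfolding smooth_def
  proof (intro allI)
    fix bs x
    show "partials bs (fourier \<phi>) differentiable at x"
      using partials_fourier[OF assms, of bs] fourier_has_derivative unfolding differentiable_def by fastforce
  qed
  moreover have "bounded (range (\<lambda>x. monomial \<alpha> x *\<^sub>R partials bs (fourier \<phi>) x))" for \<alpha> bs
  proof -
    obtain \<rho> where \<rho>: "test_function \<rho>" "partials bs (fourier \<phi>) = fourier \<rho>"
      using partials_fourier[OF assms] by blast
    obtain \<eta> c where "\<And>y. monomial \<alpha> y *\<^sub>R fourier \<rho> y = c * fourier \<eta> y"
      using monomial_fourier[OF \<rho>(1)] by blast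
    then have "range (\<lambda>x. monomial \<alpha> x *\<^sub>R partials bs (fourier \<phi>) x) = (\<lambda>z. c * z) ` range (fourier \<eta>)"
      by (simp add: \<rho>(2) image_image)
    then show ?thesis
      by (simp only: bounded_linear_image[OF bounded_fourier bounded_linear_mult_right])
  qed
  ultimately show ?thesis by (simp add: schwartz_def)
qed

text \<open>Substitution of c \<xi> for the integration variable cancels 1 / c in the phase. The
  argument y / c is the one that \<open>dilate\<close> produces, and the Jacobian is the one by
  which \<open>dilate\<close> divides.\<close>

lemma fourier_scale:
  fixes \<phi> :: "real ^ 'n::finite \<Rightarrow> complex"
  assumes "c > 0" and [measurable]: "\<phi> \<in> borel_measurable borel"
  shows "fourier \<phi> ((1 / c) *\<^sub>R y) = of_real (c ^ CARD('n)) * fourier (\<lambda>\<xi>. \<phi> (c *\<^sub>R \<xi>)) y"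
  unfolding fourier_def using assms(1)
  by (subst integral_lborel_affine[of c _ 0]) (auto simp: scaleR_conv_of_real[where 'a = complex])

section \<open>Scaling of the norms\<close>

lemma window_test_function:
  assumes "window \<psi>"
  shows "test_function \<psi>"
proof -
  have "{\<xi>. \<psi> \<xi> \<noteq> 0} \<subseteq> {\<xi>. \<forall>i. \<xi> $ i \<in> {-1..1}}"
    using assms closure_subset[of "{\<xi>. \<psi> \<xi> \<noteq> 0}"] unfolding window_def by (meson order_trans)
  also have "\<dots> = cbox (- 1) 1"
    by (simp add: set_eq_iff mem_box_cart)
  finally have "bounded {\<xi>. \<psi> \<xi> \<noteq> 0}"
    by (rule bounded_subset[OF bounded_cbox])
  then show ?thesis
    using assms by (simp add: window_def schwartz_def test_function_def)
qed

lemma freq_block_dilate: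
  fixes \<psi> :: "real ^ 'n::finite \<Rightarrow> complex"
  assumes \<psi>: "test_function \<psi>" and f: "f \<in> tempered_distributions"
  shows "freq_block \<psi> j k (dilate (2 powi j0) f) x = freq_block \<psi> (j - j0) k f ((2 powi j0) *\<^sub>R x)"
proof -
  define l :: real where "l = 2 powi j0"
  have l: "l > 0" by (simp add: l_def)
  define G where "G i x = (\<lambda>\<xi>. \<psi> (2 powi (- i) *\<^sub>R \<xi> - int_vec k) * exp (2 * pi * \<i> * (x \<bullet> \<xi>)))" for i x
  have G: "test_function (G i x)" for i x
    unfolding G_def diff_conv_add_uminus
    by (intro test_function_mult test_function_compose_affine smooth_phase \<psi>) simp
  have "2 powi (- j) * l = 2 powi (- (j - j0))"
    unfolding l_def by (subst power_int_add[symmetric]) auto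
  \<comment> \<open>The dilation acts on the window through its scale and on the phase through the
    point x; the translation k is untouched.\<close>
  then have scale: "(\<lambda>\<xi>. G j x (l *\<^sub>R \<xi>)) = G (j - j0) (l *\<^sub>R x)"
    by (simp only: G_def scaleR_scaleR inner_scaleR_left inner_scaleR_right)
  have [measurable]: "G j x \<in> borel_measurable borel"
    by (intro borel_measurable_continuous_onI test_function_continuous G)
  have S: "fourier (G (j - j0) (l *\<^sub>R x)) \<in> schwartz"
    by (intro fourier_test_function_schwartz G)
  have hom: "f (\<lambda>x. a * \<phi> x) = a * f \<phi>" if "\<phi> \<in> schwartz" for a \<phi>
  proof -
    have "\<forall>\<phi>\<in>schwartz. \<forall>\<eta>\<in>schwartz. \<forall>a b. f (\<lambda>x. a * \<phi> x + b * \<eta> x) = a * f \<phi> + b * f \<eta>"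
      using f by (simp add: tempered_distributions_def)
    from this[rule_format, OF that that, of a 0] show ?thesis by simp
  qed
  have "freq_block \<psi> j k (dilate l f) x = f (\<lambda>y. fourier (G j x) ((1 / l) *\<^sub>R y)) / of_real (l ^ CARD('n))"
    unfolding freq_block_def fourier_dist_def dilate_def G_def ..
  also have "\<dots> = f (\<lambda>y. of_real (l ^ CARD('n)) * fourier (G (j - j0) (l *\<^sub>R x)) y) / of_real (l ^ CARD('n))"
    by (subst fourier_scale[OF l]) (auto simp only: scale \<open>G j x \<in> borel_measurable borel\<close>)
  also have "\<dots> = f (fourier (G (j - j0) (l *\<^sub>R x)))"
    unfolding hom[OF S] using l by simp
  also have "\<dots> = freq_block \<psi> (j - j0) k f (l *\<^sub>R x)"
    unfolding freq_block_def fourier_dist_def G_def ..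
  finally show ?thesis unfolding l_def .
qed

text \<open>Strict positivity of a excludes the product of 0 and \<infinity>, so both sides are
  infinite together.\<close>

lemma ennpowr_mult:
  assumes "a > 0"
  shows "ennpowr (ennreal a * X) s = ennreal (a powr s) * ennpowr X s"
proof (cases X)
  case (real x)
  have "ennpowr (ennreal a * X) s = ennpowr (ennreal (a * x)) s"
    using real assms by (simp only: ennreal_mult less_imp_le)
  also have "\<dots> = ennreal (a powr s * x powr s)"
    using real assms unfolding ennpowr_def by (simp add: powr_mult)
  also have "\<dots> = ennreal (a powr s) * ennpowr X s"
    using real unfolding ennpowr_def by (simp only: ennreal_mult powr_ge_zero) simp
  finally show ?thesis .
next
  case top
  have "ennreal a * X = top" using assms by (simp add: top ennreal_mult_top)
  then show ?thesis using assms by (simp add: ennpowr_def top ennreal_mult_top)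
qed

text \<open>In [0, \<infinity>] a sum is the supremum of its finite partial sums, and multiplication
  by a constant, finite or not, commutes with suprema.\<close>

lemma infsum_cmult_right_ennreal: "(\<Sum>\<^sub>\<infinity>x\<in>A. c * f x) = c * (\<Sum>\<^sub>\<infinity>x\<in>A. f x :: ennreal)"
  by (simp add: nonneg_infsum_complete SUP_mult_left_ennreal sum_distrib_left)

lemma Lp_norm_scale:
  fixes g :: "real ^ 'n::finite \<Rightarrow> complex"
  assumes "l > 0"
  shows "Lp_norm p (\<lambda>x. g (l *\<^sub>R x)) = ennreal (l powr (- (CARD('n) / p))) * Lp_norm p g"
proof -
  let ?I = "\<lambda>g :: real ^ 'n \<Rightarrow> complex. \<integral>\<^sup>+x. ennreal (norm (g x) powr p) \<partial>lborel"
  \<comment> \<open>The substitution is applied with factor 1 / l to the dilated function, so that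
    the dilated integral is the one being expressed.\<close>
  have "?I (\<lambda>x. g (l *\<^sub>R x)) = ennreal ((1 / l) ^ CARD('n)) * ?I g"
    using nn_integral_lborel_scale[of "1 / l" "\<lambda>x. ennreal (norm (g (l *\<^sub>R x)) powr p)"] assms by simp
  then have "Lp_norm p (\<lambda>x. g (l *\<^sub>R x)) = ennreal (((1 / l) ^ CARD('n)) powr (1 / p)) * Lp_norm p g"
    unfolding Lp_norm_def using assms by (simp only: ennpowr_mult zero_less_power zero_less_divide_1_iff)
  also have "(1 / l) ^ CARD('n) = l powr (- real CARD('n))"
    using assms by (simp only: powr_minus powr_realpow power_one_over inverse_eq_divide)
  finally show ?thesis by (simp only: powr_powr) simp
qed

text \<open>Dyadic dilation carries the frequency box k of scale j - j0 onto the box k of scale j,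
  so the sum over k needs no reindexing. With q nonzero, the q-th power and the root cancel on the
  common factor.\<close>

lemma modulation_norm_dilate:
  fixes \<psi> :: "real ^ 'n::finite \<Rightarrow> complex"
  assumes "test_function \<psi>" "f \<in> tempered_distributions" "q \<noteq> 0" and l: "l = 2 powi j0"
  shows "modulation_norm \<psi> p q j (dilate l f) =
    ennreal (l powr (- (CARD('n) / p))) * modulation_norm \<psi> p q (j - j0) f"
proof -
  have "l > 0" by (simp add: l)
  have "freq_block \<psi> j k (dilate l f) = (\<lambda>x. freq_block \<psi> (j - j0) k f (l *\<^sub>R x))" for k
    unfolding l by (intro ext freq_block_dilate assms)
  then have "modulation_norm \<psi> p q j (dilate l f) =
      ennpowr (ennreal ((l powr (- (CARD('n) / p))) powr q) *
        (\<Sum>\<^sub>\<infinity>k\<in>UNIV. ennpowr (Lp_norm p (freq_block \<psi> (j - j0) k f)) q)) (1 / q)"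
    unfolding modulation_norm_def
    using \<open>l > 0\<close> by (simp only: Lp_norm_scale ennpowr_mult infsum_cmult_right_ennreal powr_gt_zero)
  also have "\<dots> = ennreal (((l powr (- (CARD('n) / p))) powr q) powr (1 / q)) * modulation_norm \<psi> p q (j - j0) f"
    unfolding modulation_norm_def using \<open>l > 0\<close> by (intro ennpowr_mult) simp
  finally show ?thesis using \<open>q \<noteq> 0\<close> by (simp add: powr_powr)
qed

theorem mainTheorem2:
  fixes \<psi> :: "real ^ 'n::finite \<Rightarrow> complex"
    and f :: "(real ^ 'n \<Rightarrow> complex) \<Rightarrow> complex"
    and p q r :: real and w :: "int \<Rightarrow> real" and j0 :: int and l :: real
  assumes "window \<psi>"
    and "1 \<le> p" and "1 \<le> q" and "1 \<le> r"
    and "multiplicative_vector_weight w"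
    and "l = 2 powi j0"
    and "f \<in> multiscale_space \<psi> p q r w"
  shows "multiscale_norm \<psi> p q r w (dilate l f) =
    ennreal (l powr (log 2 (w 1) - CARD('n) / p)) * multiscale_norm \<psi> p q r w f"
proof -
  have l: "l > 0" by (simp add: assms(6))
  have w: "w j = w 1 powi j" for j
    using assms(5) unfolding multiplicative_vector_weight_def by blast
  have w1: "w 1 > 0"
    using assms(5) unfolding multiplicative_vector_weight_def by blast
  have wpos: "w j > 0" for j
    by (subst w) (intro zero_less_power_int w1)
  define a where "a = l powr (- (CARD('n) / p))"
  have a: "a > 0" using l by (simp add: a_def)
  \<comment> \<open>The two sources of the final constant: \<open>w j0\<close> from shifting the
    scale, \<open>a\<close> from the Lebesgue norms.\<close>
  define b where "b = w j0 * a"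
  have b: "b > 0" using a wpos by (simp add: b_def)
  \<comment> \<open>The exponents j0 and log_2 (w 1) are interchanged, so that the power of 2
    collapses to \<open>w 1\<close>.\<close>
  have "l powr log 2 (w 1) = (2 powr log 2 (w 1)) powr j0"
    unfolding assms(6) by (simp add: powr_powr mult.commute flip: powr_real_of_int')
  also have "\<dots> = w j0"
    using w1 by (subst w) (simp add: powr_real_of_int')
  finally have b_eq: "l powr (log 2 (w 1) - CARD('n) / p) = b"
    unfolding b_def a_def by (metis powr_add diff_conv_add_uminus)
  have f: "f \<in> tempered_distributions"
    using assms(7) by (simp add: multiscale_space_def)
  let ?M = "\<lambda>j. modulation_norm \<psi> p q j f"
  have M: "modulation_norm \<psi> p q j (dilate l f) = ennreal a * ?M (j - j0)" for j
    unfolding a_def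
    by (rule modulation_norm_dilate[OF window_test_function[OF assms(1)] f _ assms(6)]) (use assms(3) in simp)
  have w_shift: "ennreal (w (j + j0) powr r) * (ennreal (a powr r) * X) =
      ennreal (b powr r) * (ennreal (w j powr r) * X)" for j X
  proof -
    have "w (j + j0) = w j * w j0"
      unfolding w[of "j + j0"] w[of j] w[of j0] using w1 by (intro power_int_add) simp
    then have "w (j + j0) powr r * a powr r = b powr r * w j powr r"
      using wpos[of j] wpos[of j0] a unfolding b_def by (simp add: powr_mult)
    then have "ennreal (w (j + j0) powr r) * ennreal (a powr r) = ennreal (b powr r) * ennreal (w j powr r)"
      by (metis ennreal_mult powr_ge_zero)
    then show ?thesis by (metis mult.assoc)
  qed
  have "(\<Sum>\<^sub>\<infinity>j\<in>UNIV. ennreal (w j powr r) * ennpowr (modulation_norm \<psi> p q j (dilate l f)) r) =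
      (\<Sum>\<^sub>\<infinity>j\<in>UNIV. ennreal (w j powr r) * (ennreal (a powr r) * ennpowr (?M (j - j0)) r))"
    by (simp only: M ennpowr_mult a)
  \<comment> \<open>The scales range over all integers, so translation by j0 is a bijection and the
    shift leaves no boundary terms.\<close>
  also have "\<dots> = (\<Sum>\<^sub>\<infinity>j\<in>UNIV. ennreal (w (j + j0) powr r) * (ennreal (a powr r) * ennpowr (?M (j + j0 - j0)) r))"
    by (rule infsum_reindex_bij_betw[of "\<lambda>j. j + j0" UNIV UNIV, symmetric])
       (rule bij_betw_byWitness[of _ "\<lambda>j. j - j0"], auto)
  also have "\<dots> = ennreal (b powr r) * (\<Sum>\<^sub>\<infinity>j\<in>UNIV. ennreal (w j powr r) * ennpowr (?M j) r)"
    by (simp only: w_shift infsum_cmult_right_ennreal add_diff_cancel_right')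
  finally have "multiscale_norm \<psi> p q r w (dilate l f) =
      ennreal ((b powr r) powr (1 / r)) * multiscale_norm \<psi> p q r w f"
    unfolding multiscale_norm_def using b by (simp only: ennpowr_mult powr_gt_zero)
  then show ?thesis
    using assms(4) b unfolding b_eq by (simp add: powr_powr)
qed

end
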